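(* Let $(\mathcal{H},\Sigma_{\mathcal{H}})$ be a measurable space, $P_g$ a probability measure on it, and $(P_\alpha)_{\alpha\in\mathcal{A}}$ a non-empty family of probability measures on it. Let $\mathcal{G}\subseteq\Sigma_{\mathcal{H}}$ be any sub-$\sigma$-algebra. For every $\mathcal{G}$-measurable rule $d:\mathcal{H}\to[0,1]$ and every $\alpha\in\mathcal{A}$, $$\mathrm{FUR}(d;\alpha)+\mathrm{RRL}(d)\;\ge\;1-\mathrm{TV}\big(P_g|_{\mathcal{G}},P_\alpha|_{\mathcal{G}}\big),$$ with equality for the likelihood-ratio rule $d^\star_\alpha=\mathbf{1}\{\mathbb{E}_\lambda[p\mid\mathcal{G}]>\mathbb{E}_\lambda[q\mid\mathcal{G}]\}$, where $\lambda=P_g+P_\alpha$, $p=\mathrm{d}P_g/\mathrm{d}\lambda$ and $q=\mathrm{d}P_\alpha/\mathrm{d}\lambda$. Consequently, for every $\mathcal{G}$-measurable rule $d$, $$\sup_{\alpha\in\mathcal{A}}\Big[\mathrm{FUR}(d;\alpha)+\mathrm{RRL}(d)\Big]\;\ge\;1-\delta_{\mathcal{G}},\qquad \delta_{\mathcal{G}}=\inf_{\alpha\in\mathcal{A}}\mathrm{TV}\big(P_g|_{\mathcal{G}},P_\alpha|_{\mathcal{G}}\big).$$ In particular this holds for $\mathcal{G}=\sigma(\varphi)$, where $\varphi:\mathcal{H}\to\Phi$ is the (measurable) restricted view.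
   Context: Interpretation: $\mathcal{H}$ is the space of observable interaction histories of an agent up to a candidate claim contradicting a stored belief; a latent label $Z\in\{g,a\}$ says whether the claim is genuine ($g$) or adversarial ($a$). $P_g$ is the law of the history given $Z=g$ (it does not depend on the adversary), and $P_\alpha$ is the law given $Z=a$ when the adversary uses policy $\alpha$ from the feasible set $\mathcal{A}$, assumed non-empty. No convexity, compactness or mutual absolute continuity is assumed. $P|_{\mathcal{G}}$ is the restriction of $P$ to $\mathcal{G}$. For probability measures $P,Q$ on $\mathcal{G}$, $\mathrm{TV}(P,Q)=\sup_{A\in\mathcal{G}}|P(A)-Q(A)|$. $\mathbb{E}_\lambda[\cdot\mid\mathcal{G}]$ is conditional expectation with respect to the finite measure $\lambda$ (of total mass $2$), i.e. the $\mathcal{G}$-measurable function with the same $\lambda$-integrals over sets of $\mathcal{G}$; equivalently, conditional expectation with respect to the probability measure $\lambda/2$. The measure $\lambda$ and densities $p,q$ depend on $\alpha$. A rule measurable with respect to $\mathcal{G}$ is a $\mathcal{G}$-measurable map $d:\mathcal{H}\to[0,1]$, where $d(H)$ is the probability of accepting the update. Its error rates are $$\mathrm{FUR}(d;\alpha)=\int d\,\mathrm{d}P_\alpha,\qquad \mathrm{RRL}(d)=1-\int d\,\mathrm{d}P_g.$$ Restricted view: $\Phi=[0,\infty]\times\mathcal{O}$, with $\mathcal{O}$ a four-element set of channel labels (user channel, tool output, retrieved document, shared file), carries the product of the Borel and discrete $\sigma$-algebras; $\varphi(H)=(r_t,o_t)$, where $r_t$ is the time elapsed between the most recent event that wrote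 or corroborated the contradicted belief and the candidate event ($r_t=\infty$ if there is no such event), and $o_t$ is the channel label of the candidate event. It is assumed that $\varphi$ is measurable. *)

theory Defs
  imports "HOL-Probability.Probability"
begin

definition total_variation :: "'h measure \<Rightarrow> 'h measure \<Rightarrow> real" where
  "total_variation P Q = (SUP A\<in>sets P. \<bar>measure P A - measure Q A\<bar>)"

text \<open>The setwise sum of two measures on the same measurable space.\<close>

definition measure_plus :: "'h measure \<Rightarrow> 'h measure \<Rightarrow> 'h measure" where
  "measure_plus P Q = measure_of (space P) (sets P) (\<lambda>A. emeasure P A + emeasure Q A)"

lemma space_measure_plus [simp]: "space (measure_plus P Q) = space P"
  by (simp add: measure_plus_def space_measure_of_conv)

lemma sets_measure_plus [simp, measurable_cong]: "sets (measure_plus P Q) = sets P"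
  by (simp add: measure_plus_def)

lemma emeasure_measure_plus:
  assumes "sets Q = sets P" and "A \<in> sets P"
  shows "emeasure (measure_plus P Q) A = emeasure P A + emeasure Q A"
proof (rule emeasure_measure_of[OF measure_plus_def])
  show "countably_additive (sets (measure_plus P Q)) (\<lambda>A. emeasure P A + emeasure Q A)"
  proof (rule countably_additiveI)
    fix F :: "nat \<Rightarrow> 'a set"
    assume F: "range F \<subseteq> sets (measure_plus P Q)" "disjoint_family F"
    have "(\<Sum>i. emeasure P (F i) + emeasure Q (F i)) = (\<Sum>i. emeasure P (F i)) + (\<Sum>i. emeasure Q (F i))"
      by (rule suminf_add[symmetric]) auto
    also have "\<dots> = emeasure P (\<Union>i. F i) + emeasure Q (\<Union>i. F i)"
      using F assms(1) by (simp add: suminf_emeasure)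
    finally show "(\<Sum>i. emeasure P (F i) + emeasure Q (F i))
        = emeasure P (\<Union>i. F i) + emeasure Q (\<Union>i. F i)" .
  qed
qed (use assms sets.sets_into_space in \<open>auto simp: positive_def\<close>)

text \<open>A (randomised) acceptance rule; \<open>d x\<close> is the probability of accepting at history \<open>x\<close>.\<close>

definition acceptance_rule :: "'h measure \<Rightarrow> ('h \<Rightarrow> real) \<Rightarrow> bool" where
  "acceptance_rule G d \<longleftrightarrow> d \<in> borel_measurable G \<and> (\<forall>x\<in>space G. 0 \<le> d x \<and> d x \<le> 1)"

definition FUR :: "'h measure \<Rightarrow> ('h \<Rightarrow> real) \<Rightarrow> real" where
  "FUR Pa d = (\<integral>x. d x \<partial>Pa)"

definition RRL :: "'h measure \<Rightarrow> ('h \<Rightarrow> real) \<Rightarrow> real" where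
  "RRL Pg d = 1 - (\<integral>x. d x \<partial>Pg)"

text \<open>
  The density is a real function; \<^const>\<open>RN_deriv\<close> is \<^typ>\<open>ennreal\<close>-valued, but finite almost
  everywhere in all uses below, since a probability measure is there differentiated with
  respect to a finite measure dominating it.
\<close>

definition real_density :: "'h measure \<Rightarrow> 'h measure \<Rightarrow> 'h \<Rightarrow> real" where
  "real_density L P = (\<lambda>x. enn2real (RN_deriv L P x))"

text \<open>
  Conditional expectations are determined only up to \<open>L\<close>-null sets in \<open>G\<close>, so we speak of an
  arbitrary \<open>G\<close>-measurable version. Replacing \<open>f\<close> by an \<open>L\<close>-a.e. equal function does not change
  the set of versions, so the particular choice made in \<^const>\<open>real_density\<close> is immaterial.
\<close>

definition cond_exp_version :: "'h measure \<Rightarrow> 'h measure \<Rightarrow> ('h \<Rightarrow> real) \<Rightarrow> ('h \<Rightarrow> real) \<Rightarrow> bool" where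
  "cond_exp_version L G f u \<longleftrightarrow>
     u \<in> borel_measurable G \<and> (AE x in L. u x = real_cond_exp L G f x)"

definition likelihood_ratio_rule :: "'h measure \<Rightarrow> 'h measure \<Rightarrow> 'h measure \<Rightarrow> ('h \<Rightarrow> real) \<Rightarrow> bool" where
  "likelihood_ratio_rule Pg Pa G d \<longleftrightarrow>
     (\<exists>u v. cond_exp_version (measure_plus Pg Pa) G (real_density (measure_plus Pg Pa) Pg) u \<and>
            cond_exp_version (measure_plus Pg Pa) G (real_density (measure_plus Pg Pa) Pa) v \<and>
            d = indicator {x \<in> space G. u x > v x})"

lemma likelihood_ratio_rule_real_cond_exp:
  fixes Pg Pa G :: "'h measure"
  defines "L \<equiv> measure_plus Pg Pa"
  shows "likelihood_ratio_rule Pg Pa G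
    (indicator {x \<in> space G. real_cond_exp L G (real_density L Pg) x > real_cond_exp L G (real_density L Pa) x})"
  unfolding likelihood_ratio_rule_def cond_exp_version_def L_def
  by (rule exI[of _ "real_cond_exp (measure_plus Pg Pa) G (real_density (measure_plus Pg Pa) Pg)"],
      rule exI[of _ "real_cond_exp (measure_plus Pg Pa) G (real_density (measure_plus Pg Pa) Pa)"])
    simp

definition TV_on :: "'h measure \<Rightarrow> 'h measure \<Rightarrow> 'h measure \<Rightarrow> real" where
  "TV_on G P Q = total_variation (restr_to_subalg P G) (restr_to_subalg Q G)"

definition delta :: "'h measure \<Rightarrow> 'h measure \<Rightarrow> ('i \<Rightarrow> 'h measure) \<Rightarrow> 'i set \<Rightarrow> real" where
  "delta G Pg P \<A> = (INF \<alpha>\<in>\<A>. TV_on G Pg (P \<alpha>))"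

datatype channel = User_Channel | Tool_Output | Retrieved_Document | Shared_File

text \<open>
  \<open>wt H\<close> is the set of times of the events in history \<open>H\<close> that wrote or corroborated the
  contradicted belief, \<open>tc H\<close> is the time of the candidate event and \<open>ch H\<close> its channel.
\<close>

definition elapsed_time :: "('h \<Rightarrow> real set) \<Rightarrow> ('h \<Rightarrow> real) \<Rightarrow> 'h \<Rightarrow> ennreal" where
  "elapsed_time wt tc H = (if wt H = {} then \<infinity> else ennreal (tc H - Max (wt H)))"

definition restricted_view ::
    "('h \<Rightarrow> real set) \<Rightarrow> ('h \<Rightarrow> real) \<Rightarrow> ('h \<Rightarrow> channel) \<Rightarrow> 'h \<Rightarrow> ennreal \<times> channel" where
  "restricted_view wt tc ch H = (elapsed_time wt tc H, ch H)"

definition view_space :: "(ennreal \<times> channel) measure" where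
  "view_space = borel \<Otimes>\<^sub>M count_space UNIV"

definition view_algebra :: "'h measure \<Rightarrow> ('h \<Rightarrow> ennreal \<times> channel) \<Rightarrow> 'h measure" where
  "view_algebra M \<phi> = vimage_algebra (space M) \<phi> view_space"

end

theory Submission
  imports Defs
begin

text \<open>
  For a \<open>G\<close>-measurable rule \<open>d\<close>, the error sum is \<open>1 - (\<integral>d \<partial>Pg - \<integral>d \<partial>Pa)\<close>, and the bracket equals
  \<open>\<integral>d \<sdot> (u - v) \<partial>L\<close> with \<open>u\<close>, \<open>v\<close> versions of the conditional expectations of the two densities.
  Since \<open>0 \<le> d \<le> 1\<close>, this is largest when \<open>d\<close> is the indicator of \<open>{u > v}\<close>; comparing with
  indicators of arbitrary sets of \<open>G\<close> and of their complements shows that the maximum is the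
  total variation distance on \<open>G\<close>.
\<close>

section \<open>Densities with respect to the sum of two measures\<close>

lemma finite_measure_measure_plus:
  assumes "finite_measure P" "finite_measure Q" "sets Q = sets P"
  shows "finite_measure (measure_plus P Q)"
proof (rule finite_measureI)
  interpret P: finite_measure P by fact
  interpret Q: finite_measure Q by fact
  have "emeasure Q (space P) \<noteq> \<infinity>"
    using sets_eq_imp_space_eq[OF assms(3)] Q.emeasure_finite by auto
  then show "emeasure (measure_plus P Q) (space (measure_plus P Q)) \<noteq> \<infinity>"
    by (simp add: emeasure_measure_plus assms(3))
qed

text \<open>A sum of two nonnegative values is zero only if both are. This is what allows both laws
  to be differentiated with respect to their sum.\<close>

lemma absolutely_continuous_measure_plus:
  assumes "sets Q = sets P"
  shows "absolutely_continuous (measure_plus P Q) P" "absolutely_continuous (measure_plus P Q) Q"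
  using assms by (auto simp: absolutely_continuous_def null_sets_def emeasure_measure_plus)

text \<open>Radon-Nikodym moves the integral from \<open>Q\<close> to \<open>L\<close>; as
  \<open>d\<close> is \<open>G\<close>-measurable, the density may then be replaced by its
  conditional expectation, and that by any a.e. equal version. Integrability is recorded so that two
  such integrals can be subtracted and compared later.\<close>

lemma integral_eq_integral_cond_exp_version:
  fixes L G Q :: "'h measure" and d u :: "'h \<Rightarrow> real"
  assumes L: "finite_measure L" and Q: "finite_measure Q"
    and ac: "absolutely_continuous L Q" and sets_Q: "sets Q = sets L"
    and sub: "subalgebra L G"
    and u: "cond_exp_version L G (real_density L Q) u"
    and d: "acceptance_rule G d"
  shows "integrable L (\<lambda>x. d x * u x)" "(\<integral>x. d x \<partial>Q) = (\<integral>x. d x * u x \<partial>L)"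
proof -
  interpret L: finite_measure L by fact
  interpret Q: finite_measure Q by fact
  interpret S: finite_measure_subalgebra L G
    by unfold_locales (fact sub)
  have dG [measurable]: "d \<in> borel_measurable G"
    and bd: "\<And>x. x \<in> space G \<Longrightarrow> 0 \<le> d x \<and> d x \<le> 1"
    using d by (auto simp: acceptance_rule_def)
  have [measurable]: "d \<in> borel_measurable L" by (rule measurable_from_subalg[OF sub dG])
  have [measurable]: "d \<in> borel_measurable Q" by (simp add: measurable_cong_sets[OF sets_Q refl])
  have uG: "u \<in> borel_measurable G" and uAE: "AE x in L. u x = real_cond_exp L G (real_density L Q) x"
    using u by (auto simp: cond_exp_version_def)
  have [measurable]: "u \<in> borel_measurable L" by (rule measurable_from_subalg[OF sub uG])
  have [measurable]: "real_density L Q \<in> borel_measurable L"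
    unfolding real_density_def by measurable
  have spQ: "space Q = space G"
    using sub sets_eq_imp_space_eq[OF sets_Q] by (simp add: subalgebra_def)
  \<comment> \<open>A bounded function is integrable for a finite measure; this carries over to the
    product of \<open>d\<close> with the density under \<open>L\<close>.\<close>
  have "integrable Q d"
    by (rule Q.integrable_const_bound[where B = 1]) (use bd spQ in auto)
  then have int: "integrable L (\<lambda>x. d x * real_density L Q x)"
    using L.RN_deriv_integrable[OF Q.sigma_finite_measure_axioms ac sets_Q, of d]
    by (simp add: real_density_def mult.commute)
  have AE_eq: "AE x in L. d x * real_cond_exp L G (real_density L Q) x = d x * u x"
    using uAE by eventually_elim simp
  \<comment> \<open>The defining property of conditional expectation, tested against the
    \<open>G\<close>-measurable factor \<open>d\<close>.\<close>
  have "integrable L (\<lambda>x. d x * real_cond_exp L G (real_density L Q) x)"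
    by (rule S.real_cond_exp_intg(1)[OF int]) auto
  then show "integrable L (\<lambda>x. d x * u x)"
    using integrable_cong_AE[OF _ _ AE_eq] by simp
  have "(\<integral>x. d x \<partial>Q) = (\<integral>x. d x * real_density L Q x \<partial>L)"
    using L.RN_deriv_integral[OF Q.sigma_finite_measure_axioms ac sets_Q, of d]
    by (simp add: real_density_def mult.commute)
  also have "\<dots> = (\<integral>x. d x * real_cond_exp L G (real_density L Q) x \<partial>L)"
    by (rule S.real_cond_exp_intg(2)[OF int, symmetric]) auto
  also have "\<dots> = (\<integral>x. d x * u x \<partial>L)"
    by (rule integral_cong_AE[OF _ _ AE_eq]) auto
  finally show "(\<integral>x. d x \<partial>Q) = (\<integral>x. d x * u x \<partial>L)" .
qed

section \<open>Likelihood-ratio rules and the bound for a single policy\<close>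

lemma acceptance_rule_indicator:
  "A \<in> sets G \<Longrightarrow> acceptance_rule G (indicator A)"
  by (auto simp: acceptance_rule_def indicator_def)

lemma acceptance_rule_likelihood_ratio:
  fixes Pg Pa G :: "'h measure"
  assumes "likelihood_ratio_rule Pg Pa G d"
  shows "acceptance_rule G d"
proof -
  obtain u v :: "'h \<Rightarrow> real" where [measurable]: "u \<in> borel_measurable G" "v \<in> borel_measurable G"
    and d: "d = indicator {x \<in> space G. u x > v x}"
    using assms unfolding likelihood_ratio_rule_def cond_exp_version_def by blast
  show ?thesis
    unfolding d by (rule acceptance_rule_indicator) measurable
qed

text \<open>One adversary policy at a time: \<open>Pa\<close> stands for a single member of the
  family, which enters only with the supremum.\<close>

locale hypothesis_pair =
  fixes M G Pg Pa :: "'h measure"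
  assumes prob_Pg: "prob_space Pg" and prob_Pa: "prob_space Pa"
    and sets_Pg: "sets Pg = sets M" and sets_Pa: "sets Pa = sets M"
    and subalg: "subalgebra M G"
begin

lemma space_G: "space Pg = space G" "space Pa = space G"
  using subalg sets_eq_imp_space_eq[OF sets_Pg] sets_eq_imp_space_eq[OF sets_Pa]
  by (auto simp: subalgebra_def)

lemma sets_G: "A \<in> sets G \<Longrightarrow> A \<in> sets Pg" "A \<in> sets G \<Longrightarrow> A \<in> sets Pa"
  using subalg by (auto simp: sets_Pg sets_Pa subalgebra_def)

lemma subalg_Pg: "subalgebra Pg G" and subalg_Pa: "subalgebra Pa G"
  using sets_G space_G by (auto simp: subalgebra_def)

lemma integral_rule_bounds:
  assumes "acceptance_rule G d"
  shows "0 \<le> (\<integral>x. d x \<partial>Pg)" "(\<integral>x. d x \<partial>Pa) \<le> 1"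
proof -
  interpret Pa: prob_space Pa by (fact prob_Pa)
  have d: "d \<in> borel_measurable G" "\<And>x. x \<in> space G \<Longrightarrow> 0 \<le> d x \<and> d x \<le> 1"
    using assms by (auto simp: acceptance_rule_def)
  have [measurable]: "d \<in> borel_measurable Pa"
    by (rule measurable_from_subalg[OF subalg_Pa d(1)])
  show "0 \<le> (\<integral>x. d x \<partial>Pg)"
    by (rule integral_nonneg_AE) (use d(2) space_G in auto)
  have "integrable Pa d"
    by (rule Pa.integrable_const_bound[where B = 1]) (use d space_G in auto)
  then show "(\<integral>x. d x \<partial>Pa) \<le> 1"
    by (rule Pa.integral_le_const) (use d(2) space_G in auto)
qed

text \<open>A Neyman-Pearson argument with equal weights on both errors: the integrand is maximised
  pointwise.\<close>

lemma likelihood_ratio_rule_optimal: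
  assumes opt: "likelihood_ratio_rule Pg Pa G d'" and d: "acceptance_rule G d"
  shows "(\<integral>x. d x \<partial>Pg) - (\<integral>x. d x \<partial>Pa) \<le> (\<integral>x. d' x \<partial>Pg) - (\<integral>x. d' x \<partial>Pa)"
proof -
  interpret Pg: prob_space Pg by (fact prob_Pg)
  interpret Pa: prob_space Pa by (fact prob_Pa)
  define L where "L = measure_plus Pg Pa"
  have sets_eq: "sets Pa = sets Pg" by (simp add: sets_Pg sets_Pa)
  have L: "finite_measure L"
    unfolding L_def
    by (rule finite_measure_measure_plus) (fact Pg.finite_measure_axioms Pa.finite_measure_axioms sets_eq)+
  have ac: "absolutely_continuous L Pg" "absolutely_continuous L Pa"
    unfolding L_def using absolutely_continuous_measure_plus[OF sets_eq] by auto
  have sets_L: "sets Pg = sets L" "sets Pa = sets L" by (simp_all add: L_def sets_eq)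
  have space_L: "space L = space G" by (simp add: L_def space_G)
  have subL: "subalgebra L G" using subalg_Pg by (simp add: subalgebra_def L_def)
  obtain u v where u: "cond_exp_version L G (real_density L Pg) u"
    and v: "cond_exp_version L G (real_density L Pa) v"
    and d': "d' = indicator {x \<in> space G. u x > v x}"
    using opt unfolding likelihood_ratio_rule_def L_def by blast
  note Pg_int = integral_eq_integral_cond_exp_version[OF L Pg.finite_measure_axioms ac(1) sets_L(1) subL u]
  note Pa_int = integral_eq_integral_cond_exp_version[OF L Pa.finite_measure_axioms ac(2) sets_L(2) subL v]
  \<comment> \<open>Stated for every rule \<open>e\<close>, since it is applied to both competitors
    \<open>d\<close> and \<open>d'\<close>.\<close>
  have diff: "integrable L (\<lambda>x. e x * u x - e x * v x)"
    "(\<integral>x. e x \<partial>Pg) - (\<integral>x. e x \<partial>Pa) = (\<integral>x. e x * u x - e x * v x \<partial>L)"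
    if "acceptance_rule G e" for e
    using Pg_int[OF that] Pa_int[OF that] by simp_all
  have rule': "acceptance_rule G d'" by (rule acceptance_rule_likelihood_ratio[OF opt])
  have "(\<integral>x. d x * u x - d x * v x \<partial>L) \<le> (\<integral>x. d' x * u x - d' x * v x \<partial>L)"
  proof (rule integral_mono[OF diff(1)[OF d] diff(1)[OF rule']])
    fix x assume "x \<in> space L"
    then have x: "x \<in> space G" "0 \<le> d x" "d x \<le> 1"
      using d by (auto simp: space_L acceptance_rule_def)
    \<comment> \<open>Where \<open>u x - v x\<close> is positive, \<open>d'\<close> takes the
      largest admissible value 1; elsewhere it takes the smallest, 0.\<close>
    have "d x * (u x - v x) \<le> d' x * (u x - v x)"
    proof (cases "v x < u x")
      case True
      then show ?thesis using x by (simp add: d' mult_left_le_one_le)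
    next
      case False
      then show ?thesis using x by (simp add: d' mult_nonneg_nonpos)
    qed
    then show "d x * u x - d x * v x \<le> d' x * u x - d' x * v x"
      by (simp add: right_diff_distrib)
  qed
  then show ?thesis unfolding diff(2)[OF d] diff(2)[OF rule'] .
qed

lemma TV_on_eq:
  assumes opt: "likelihood_ratio_rule Pg Pa G d"
  shows "TV_on G Pg Pa = (\<integral>x. d x \<partial>Pg) - (\<integral>x. d x \<partial>Pa)"
proof -
  interpret Pg: prob_space Pg by (fact prob_Pg)
  interpret Pa: prob_space Pa by (fact prob_Pa)
  let ?D = "(\<integral>x. d x \<partial>Pg) - (\<integral>x. d x \<partial>Pa)"
  have integral_ind: "(\<integral>x. indicator A x \<partial>Pg) = measure Pg A"
    "(\<integral>x. indicator A x \<partial>Pa) = measure Pa A" if "A \<in> sets G" for A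
    using sets_G[OF that] by simp_all
  \<comment> \<open>The indicator of \<open>A\<close> is itself a rule, so optimality applies to
    it.\<close>
  have one_sided: "measure Pg A - measure Pa A \<le> ?D" if "A \<in> sets G" for A
    using likelihood_ratio_rule_optimal[OF opt acceptance_rule_indicator[OF that]]
    by (simp only: integral_ind[OF that])
  have bound: "\<bar>measure Pg A - measure Pa A\<bar> \<le> ?D" if A: "A \<in> sets G" for A
  proof -
    \<comment> \<open>Both laws have mass 1, so passing to the complement flips the sign of the
      difference and yields the other half of the absolute value.\<close>
    have "measure Pg (space G - A) = 1 - measure Pg A" "measure Pa (space G - A) = 1 - measure Pa A"
      using Pg.prob_compl Pa.prob_compl sets_G[OF A] space_G by auto
    then show ?thesis using one_sided[OF A] one_sided[OF sets.compl_sets[OF A]] by auto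
  qed
  obtain u v :: "'h \<Rightarrow> real" where [measurable]: "u \<in> borel_measurable G" "v \<in> borel_measurable G"
    and d: "d = indicator {x \<in> space G. u x > v x}"
    using opt unfolding likelihood_ratio_rule_def cond_exp_version_def by blast
  let ?S = "{x \<in> space G. u x > v x}"
  have S: "?S \<in> sets G" by measurable
  have D: "?D = measure Pg ?S - measure Pa ?S"
    unfolding d by (simp only: integral_ind[OF S])
  have "TV_on G Pg Pa = (SUP A\<in>sets G. \<bar>measure Pg A - measure Pa A\<bar>)"
    unfolding TV_on_def total_variation_def sets_restr_to_subalg[OF subalg_Pg]
    by (intro SUP_cong refl)
      (simp add: measure_def emeasure_restr_to_subalg[OF subalg_Pg] emeasure_restr_to_subalg[OF subalg_Pa])
  also have "\<dots> = ?D"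
  proof (rule cSup_eq_maximum)
    \<comment> \<open>At \<open>?S\<close> the bound reads \<open>\<bar>?D\<bar> \<le> ?D\<close>,
      so \<open>?D\<close> equals its absolute value and the supremum is attained at
      \<open>?S\<close>.\<close>
    show "?D \<in> (\<lambda>A. \<bar>measure Pg A - measure Pa A\<bar>) ` sets G"
      using bound[OF S] S unfolding D by (intro image_eqI[OF _ S]) linarith
  qed (use bound in auto)
  finally show ?thesis .
qed

text \<open>The versions given by \<open>real_cond_exp\<close> itself supply a likelihood-ratio rule
  to compare \<open>d\<close> with.\<close>

theorem error_sum_ge:
  assumes "acceptance_rule G d"
  shows "FUR Pa d + RRL Pg d \<ge> 1 - TV_on G Pg Pa"
  using likelihood_ratio_rule_optimal[OF likelihood_ratio_rule_real_cond_exp assms]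
    TV_on_eq[OF likelihood_ratio_rule_real_cond_exp]
  by (simp add: FUR_def RRL_def)

theorem error_sum_likelihood_ratio_rule:
  assumes "likelihood_ratio_rule Pg Pa G d"
  shows "FUR Pa d + RRL Pg d = 1 - TV_on G Pg Pa"
  using TV_on_eq[OF assms] by (simp add: FUR_def RRL_def)

text \<open>Serves to make the real-valued supremum over policies that of a bounded set.\<close>

lemma error_sum_le:
  assumes "acceptance_rule G d"
  shows "FUR Pa d + RRL Pg d \<le> 2"
  using integral_rule_bounds[OF assms] by (simp add: FUR_def RRL_def)

end

section \<open>Supremum over policies and the restricted view\<close>

lemma SUP_error_sum_ge:
  assumes pair: "\<And>\<alpha>. \<alpha> \<in> \<A> \<Longrightarrow> hypothesis_pair M G Pg (P \<alpha>)"
    and "\<A> \<noteq> {}" and d: "acceptance_rule G d"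
  shows "(SUP \<alpha>\<in>\<A>. FUR (P \<alpha>) d + RRL Pg d) \<ge> 1 - delta G Pg P \<A>"
proof -
  let ?s = "SUP \<alpha>\<in>\<A>. FUR (P \<alpha>) d + RRL Pg d"
  have bdd: "bdd_above ((\<lambda>\<alpha>. FUR (P \<alpha>) d + RRL Pg d) ` \<A>)"
    using hypothesis_pair.error_sum_le[OF pair d] by (intro bdd_aboveI2)
  \<comment> \<open>Rearranged so that \<open>1 - ?s\<close>, free of \<open>\<alpha>\<close>, is a
    common lower bound of the distances and hence lies below their infimum.\<close>
  have "1 - ?s \<le> TV_on G Pg (P \<alpha>)" if "\<alpha> \<in> \<A>" for \<alpha>
    using cSUP_upper[OF that bdd] hypothesis_pair.error_sum_ge[OF pair[OF that] d] by linarith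
  then have "1 - ?s \<le> delta G Pg P \<A>"
    unfolding delta_def using \<open>\<A> \<noteq> {}\<close> by (intro cINF_greatest)
  then show ?thesis by linarith
qed

text \<open>The generated sets are the preimages of measurable sets under \<open>\<phi>\<close>, and
  these lie in \<open>M\<close> by measurability of \<open>\<phi>\<close>.\<close>

lemma subalgebra_view_algebra:
  assumes "\<phi> \<in> M \<rightarrow>\<^sub>M view_space"
  shows "subalgebra M (view_algebra M \<phi>)"
  unfolding subalgebra_def view_algebra_def
  using assms by (auto simp: sets_vimage_algebra2 measurable_space intro: measurable_sets)

text \<open>In the restricted view, the condition on \<open>wt\<close> and \<open>tc\<close> makes
  \<open>Max (wt H)\<close> a genuine maximum when \<open>wt H\<close> is non-empty and the elapsed
  time nonnegative, so that \<open>ennreal\<close> truncates nothing.\<close>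

theorem theorem2:
  fixes M :: "'h measure" and Pg :: "'h measure"
    and P :: "'i \<Rightarrow> 'h measure" and \<A> :: "'i set"
  assumes "prob_space Pg" and "sets Pg = sets M"
    and "\<And>\<alpha>. \<alpha> \<in> \<A> \<Longrightarrow> prob_space (P \<alpha>)" and "\<And>\<alpha>. \<alpha> \<in> \<A> \<Longrightarrow> sets (P \<alpha>) = sets M"
    and "\<A> \<noteq> {}"
  shows
    "(\<forall>G. subalgebra M G \<longrightarrow>
        (\<forall>d \<alpha>. acceptance_rule G d \<longrightarrow> \<alpha> \<in> \<A> \<longrightarrow>
           FUR (P \<alpha>) d + RRL Pg d \<ge> 1 - TV_on G Pg (P \<alpha>)) \<and>
        (\<forall>d \<alpha>. \<alpha> \<in> \<A> \<longrightarrow> likelihood_ratio_rule Pg (P \<alpha>) G d \<longrightarrow>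
           acceptance_rule G d \<and> FUR (P \<alpha>) d + RRL Pg d = 1 - TV_on G Pg (P \<alpha>)) \<and>
        (\<forall>d. acceptance_rule G d \<longrightarrow>
           (SUP \<alpha>\<in>\<A>. FUR (P \<alpha>) d + RRL Pg d) \<ge> 1 - delta G Pg P \<A>)) \<and>
     (\<forall>wt tc ch \<phi> G.
        (\<forall>H\<in>space M. finite (wt H) \<and> (\<forall>s\<in>wt H. s \<le> tc H)) \<longrightarrow>
        \<phi> = restricted_view wt tc ch \<longrightarrow> \<phi> \<in> M \<rightarrow>\<^sub>M view_space \<longrightarrow> G = view_algebra M \<phi> \<longrightarrow>
        subalgebra M G \<and>
        (\<forall>d \<alpha>. acceptance_rule G d \<longrightarrow> \<alpha> \<in> \<A> \<longrightarrow>
           FUR (P \<alpha>) d + RRL Pg d \<ge> 1 - TV_on G Pg (P \<alpha>)) \<and>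
        (\<forall>d \<alpha>. \<alpha> \<in> \<A> \<longrightarrow> likelihood_ratio_rule Pg (P \<alpha>) G d \<longrightarrow>
           acceptance_rule G d \<and> FUR (P \<alpha>) d + RRL Pg d = 1 - TV_on G Pg (P \<alpha>)) \<and>
        (\<forall>d. acceptance_rule G d \<longrightarrow>
           (SUP \<alpha>\<in>\<A>. FUR (P \<alpha>) d + RRL Pg d) \<ge> 1 - delta G Pg P \<A>))"
proof -
  have pair: "hypothesis_pair M G Pg (P \<alpha>)" if "subalgebra M G" "\<alpha> \<in> \<A>" for G \<alpha>
    using assms that by (simp add: hypothesis_pair_def)
  have main: "(\<forall>d \<alpha>. acceptance_rule G d \<longrightarrow> \<alpha> \<in> \<A> \<longrightarrow>
           FUR (P \<alpha>) d + RRL Pg d \<ge> 1 - TV_on G Pg (P \<alpha>)) \<and>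
        (\<forall>d \<alpha>. \<alpha> \<in> \<A> \<longrightarrow> likelihood_ratio_rule Pg (P \<alpha>) G d \<longrightarrow>
           acceptance_rule G d \<and> FUR (P \<alpha>) d + RRL Pg d = 1 - TV_on G Pg (P \<alpha>)) \<and>
        (\<forall>d. acceptance_rule G d \<longrightarrow>
           (SUP \<alpha>\<in>\<A>. FUR (P \<alpha>) d + RRL Pg d) \<ge> 1 - delta G Pg P \<A>)"
    if "subalgebra M G" for G
  proof (intro conjI allI impI)
    note pair = pair[OF that]
    show "FUR (P \<alpha>) d + RRL Pg d \<ge> 1 - TV_on G Pg (P \<alpha>)"
      if "acceptance_rule G d" "\<alpha> \<in> \<A>" for d \<alpha>
      using hypothesis_pair.error_sum_ge[OF pair] that by blast
    show "acceptance_rule G d"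
      if "likelihood_ratio_rule Pg (P \<alpha>) G d" for d \<alpha>
      using acceptance_rule_likelihood_ratio that by blast
    show "FUR (P \<alpha>) d + RRL Pg d = 1 - TV_on G Pg (P \<alpha>)"
      if "\<alpha> \<in> \<A>" "likelihood_ratio_rule Pg (P \<alpha>) G d" for d \<alpha>
      using hypothesis_pair.error_sum_likelihood_ratio_rule[OF pair] that by blast
    show "(SUP \<alpha>\<in>\<A>. FUR (P \<alpha>) d + RRL Pg d) \<ge> 1 - delta G Pg P \<A>"
      if "acceptance_rule G d" for d
      using pair assms(5) that by (rule SUP_error_sum_ge)
  qed
  \<comment> \<open>The restricted view is the instance of \<open>main\<close> at
    \<open>view_algebra M \<phi>\<close>.\<close>
  show ?thesis
    using main subalgebra_view_algebra by blast
qed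

end
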